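(* Let $V=I+C$ be a bounded linear operator on $L^2(\Gamma)$ with $C$ compact, and suppose that $V$ is invertible. Let $X_N\subset L^2(\Gamma)$, $N=1,2,\ldots$, be finite-dimensional subspaces with corresponding orthogonal projections $P_N:L^2(\Gamma)\to X_N$ satisfying $P_N\phi\to\phi$ as $N\to\infty$ for every $\phi\in L^2(\Gamma)$, and let $V^N$ be the Galerkin matrix of $V$ with respect to an orthonormal basis of $X_N$. Then $V^N$ is invertible for all sufficiently large $N$, and $$\|(V^N)^{-1}\|\to\|V^{-1}\|\quad\text{as }N\to\infty.$$
   Context: $\Gamma$ is the Lipschitz boundary of a compact set $\Omega\subset\mathbb{R}^d$ ($d=2$ or $3$) with connected complement. If $\{\phi_1,\ldots,\phi_n\}$ is an orthonormal basis of $X_N$ ($n=\dim X_N$), the Galerkin matrix is $V^N=[(V\phi_j,\phi_i)]_{i,j}$, where $(\cdot,\cdot)$ is the $L^2(\Gamma)$ inner product. For operators on $L^2(\Gamma)$, $\|\cdot\|$ is the operator norm; for matrices, it is the norm induced by the Euclidean vector norm. *)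

theory Defs
  imports
    "HOL-Analysis.Analysis"
    "Jordan_Normal_Form.Gauss_Jordan_Elimination"
begin

text \<open>Near each boundary point, \<open>S\<close> is the closed hypograph, in some direction \<open>e\<close>, of a
  Lipschitz function on the hyperplane orthogonal to \<open>e\<close>. The inequality is non-strict because
  the definition is meant for closed \<open>S\<close>; it forces \<open>frontier S\<close> to be locally the graph.\<close>

definition lipschitz_boundary :: "'a::euclidean_space set \<Rightarrow> bool" where
  "lipschitz_boundary S \<longleftrightarrow>
     (\<forall>x\<in>frontier S. \<exists>U e L g. open U \<and> x \<in> U \<and> norm e = 1 \<and>
        L-lipschitz_on {z. inner z e = 0} g \<and>
        S \<inter> U = {y \<in> U. inner y e \<le> g (y - inner y e *\<^sub>R e)})"

text \<open>The \<open>k\<close>-dimensional Hausdorff measure (\<open>k \<ge> 1\<close>), normalised by the volume of the unit ball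
  of \<open>\<real>\<^sup>k\<close> so that it is the usual surface measure on \<open>k\<close>-dimensional Lipschitz graphs. Covering
  sets are required to be bounded since \<open>diameter\<close> is meaningless on unbounded sets.\<close>

definition hausdorff_pre :: "real \<Rightarrow> nat \<Rightarrow> 'a::euclidean_space set \<Rightarrow> ennreal" where
  "hausdorff_pre \<delta> k E =
     (INF A \<in> {A :: nat \<Rightarrow> 'a set. E \<subseteq> (\<Union>i. A i) \<and> (\<forall>i. bounded (A i) \<and> diameter (A i) \<le> \<delta>)}.
        (\<Sum>i. ennreal (unit_ball_vol (real k) * (diameter (A i) / 2) ^ k)))"

definition hausdorff_outer :: "nat \<Rightarrow> 'a::euclidean_space set \<Rightarrow> ennreal" where
  "hausdorff_outer k E = (SUP \<delta> \<in> {0<..}. hausdorff_pre \<delta> k E)"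

text \<open>\<open>hausdorff_outer k\<close> is a metric outer measure, hence countably additive on the Borel sets
  (Caratheodory's criterion), so \<open>measure_of\<close> does not fall back to the zero measure here.\<close>

definition hausdorff_measure :: "nat \<Rightarrow> 'a::euclidean_space measure" where
  "hausdorff_measure k = measure_of UNIV (sets borel) (hausdorff_outer k)"

definition surface_measure :: "'a::euclidean_space set \<Rightarrow> 'a measure" where
  "surface_measure \<Gamma> = restrict_space (hausdorff_measure (DIM('a) - 1)) \<Gamma>"


text \<open>Elements of L2 are represented by square-integrable functions, two of which are the same
  element when they agree almost everywhere. All notions below respect this identification, and
  subspaces are saturated, i.e. closed under it. Values outside \<open>space M\<close> play no role.\<close>

definition L2 :: "'a measure \<Rightarrow> ('a \<Rightarrow> complex) set" where
  "L2 M = {f \<in> borel_measurable M. integrable M (\<lambda>x. (cmod (f x))\<^sup>2)}"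

definition L2_eq :: "'a measure \<Rightarrow> ('a \<Rightarrow> complex) \<Rightarrow> ('a \<Rightarrow> complex) \<Rightarrow> bool" where
  "L2_eq M f g \<longleftrightarrow> (AE x in M. f x = g x)"

definition L2_inner :: "'a measure \<Rightarrow> ('a \<Rightarrow> complex) \<Rightarrow> ('a \<Rightarrow> complex) \<Rightarrow> complex" where
  "L2_inner M f g = integral\<^sup>L M (\<lambda>x. f x * cnj (g x))"

definition L2_norm :: "'a measure \<Rightarrow> ('a \<Rightarrow> complex) \<Rightarrow> real" where
  "L2_norm M f = sqrt (integral\<^sup>L M (\<lambda>x. (cmod (f x))\<^sup>2))"

definition L2_bounded_linear ::
  "'a measure \<Rightarrow> (('a \<Rightarrow> complex) \<Rightarrow> ('a \<Rightarrow> complex)) \<Rightarrow> bool" where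
  "L2_bounded_linear M A \<longleftrightarrow>
     (\<forall>f\<in>L2 M. A f \<in> L2 M) \<and>
     (\<forall>f\<in>L2 M. \<forall>g\<in>L2 M. L2_eq M (A (\<lambda>x. f x + g x)) (\<lambda>x. A f x + A g x)) \<and>
     (\<forall>c. \<forall>f\<in>L2 M. L2_eq M (A (\<lambda>x. c * f x)) (\<lambda>x. c * A f x)) \<and>
     (\<exists>K. \<forall>f\<in>L2 M. L2_norm M (A f) \<le> K * L2_norm M f)"

definition L2_compact ::
  "'a measure \<Rightarrow> (('a \<Rightarrow> complex) \<Rightarrow> ('a \<Rightarrow> complex)) \<Rightarrow> bool" where
  "L2_compact M A \<longleftrightarrow>
     L2_bounded_linear M A \<and>
     (\<forall>f :: nat \<Rightarrow> 'a \<Rightarrow> complex. \<forall>R. (\<forall>n. f n \<in> L2 M \<and> L2_norm M (f n) \<le> R) \<longrightarrow>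
        (\<exists>g\<in>L2 M. \<exists>r :: nat \<Rightarrow> nat. strict_mono r \<and>
           (\<lambda>n. L2_norm M (\<lambda>x. A (f (r n)) x - g x)) \<longlonglongrightarrow> 0))"

definition L2_opnorm ::
  "'a measure \<Rightarrow> (('a \<Rightarrow> complex) \<Rightarrow> ('a \<Rightarrow> complex)) \<Rightarrow> real" where
  "L2_opnorm M A = Sup {L2_norm M (A f) | f. f \<in> L2 M \<and> L2_norm M f \<le> 1}"

definition L2_inverts ::
  "'a measure \<Rightarrow> (('a \<Rightarrow> complex) \<Rightarrow> ('a \<Rightarrow> complex)) \<Rightarrow>
     (('a \<Rightarrow> complex) \<Rightarrow> ('a \<Rightarrow> complex)) \<Rightarrow> bool" where
  "L2_inverts M A B \<longleftrightarrow>
     L2_bounded_linear M B \<and> (\<forall>f\<in>L2 M. L2_eq M (A (B f)) f \<and> L2_eq M (B (A f)) f)"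

definition L2_invertible ::
  "'a measure \<Rightarrow> (('a \<Rightarrow> complex) \<Rightarrow> ('a \<Rightarrow> complex)) \<Rightarrow> bool" where
  "L2_invertible M A \<longleftrightarrow> (\<exists>B. L2_inverts M A B)"

text \<open>The inverse is unique only up to almost-everywhere equality of its values.\<close>

definition L2_inv ::
  "'a measure \<Rightarrow> (('a \<Rightarrow> complex) \<Rightarrow> ('a \<Rightarrow> complex)) \<Rightarrow>
     (('a \<Rightarrow> complex) \<Rightarrow> ('a \<Rightarrow> complex))" where
  "L2_inv M A = (SOME B. L2_inverts M A B)"

definition L2_subspace :: "'a measure \<Rightarrow> ('a \<Rightarrow> complex) set \<Rightarrow> bool" where
  "L2_subspace M X \<longleftrightarrow>
     X \<subseteq> L2 M \<and> (\<lambda>_. 0) \<in> X \<and>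
     (\<forall>f\<in>X. \<forall>g\<in>X. (\<lambda>x. f x + g x) \<in> X) \<and>
     (\<forall>c. \<forall>f\<in>X. (\<lambda>x. c * f x) \<in> X) \<and>
     (\<forall>f\<in>X. \<forall>g\<in>L2 M. L2_eq M f g \<longrightarrow> g \<in> X)"

definition L2_spans :: "'a measure \<Rightarrow> ('a \<Rightarrow> complex) set \<Rightarrow> ('a \<Rightarrow> complex) list \<Rightarrow> bool" where
  "L2_spans M X bs \<longleftrightarrow>
     set bs \<subseteq> X \<and>
     (\<forall>f\<in>X. \<exists>c :: nat \<Rightarrow> complex. L2_eq M f (\<lambda>x. \<Sum>i<length bs. c i * (bs ! i) x))"

definition L2_finite_dim :: "'a measure \<Rightarrow> ('a \<Rightarrow> complex) set \<Rightarrow> bool" where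
  "L2_finite_dim M X \<longleftrightarrow> (\<exists>bs. L2_spans M X bs)"

definition L2_orthonormal_basis ::
  "'a measure \<Rightarrow> ('a \<Rightarrow> complex) set \<Rightarrow> ('a \<Rightarrow> complex) list \<Rightarrow> bool" where
  "L2_orthonormal_basis M X bs \<longleftrightarrow>
     L2_spans M X bs \<and>
     (\<forall>i<length bs. \<forall>j<length bs. L2_inner M (bs ! i) (bs ! j) = (if i = j then 1 else 0))"

definition L2_orthogonal_projection ::
  "'a measure \<Rightarrow> ('a \<Rightarrow> complex) set \<Rightarrow> (('a \<Rightarrow> complex) \<Rightarrow> ('a \<Rightarrow> complex)) \<Rightarrow> bool" where
  "L2_orthogonal_projection M X P \<longleftrightarrow>
     (\<forall>f\<in>L2 M. P f \<in> X \<and> (\<forall>g\<in>X. L2_inner M (\<lambda>x. f x - P f x) g = 0))"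


definition galerkin_matrix ::
  "'a measure \<Rightarrow> (('a \<Rightarrow> complex) \<Rightarrow> ('a \<Rightarrow> complex)) \<Rightarrow> ('a \<Rightarrow> complex) list \<Rightarrow> complex mat" where
  "galerkin_matrix M A bs =
     Matrix.mat (length bs) (length bs) (\<lambda>(i, j). L2_inner M (A (bs ! j)) (bs ! i))"

definition euclidean_vec_norm :: "complex Matrix.vec \<Rightarrow> real" where
  "euclidean_vec_norm v = sqrt (\<Sum>i<dim_vec v. (cmod (vec_index v i))\<^sup>2)"

definition mat_norm :: "complex mat \<Rightarrow> real" where
  "mat_norm A =
     Sup {euclidean_vec_norm (A *\<^sub>v v) | v. v \<in> carrier_vec (dim_col A) \<and> euclidean_vec_norm v \<le> 1}"

end

theory Submission
  imports Defs "Jordan_Normal_Form.Determinant"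
begin

text \<open>On \<open>X\<^sub>N\<close> the Galerkin operator satisfies \<open>P\<^sub>N V \<phi> = V \<phi> + (P\<^sub>N - I) C \<phi>\<close>, and \<open>(P\<^sub>N - I) C\<close>
  tends to zero in operator norm because \<open>C\<close> is compact. So the Galerkin operators are
  asymptotically bounded below by \<open>1 / \<parallel>V\<^sup>-\<^sup>1\<parallel>\<close>, which yields invertibility and
  \<open>limsup \<parallel>(V\<^sup>N)\<^sup>-\<^sup>1\<parallel> \<le> \<parallel>V\<^sup>-\<^sup>1\<parallel>\<close>. Conversely, for \<open>u = V\<^sup>-\<^sup>1 g\<close> the estimate
  \<open>\<parallel>P\<^sub>N u\<parallel> \<le> \<parallel>(V\<^sup>N)\<^sup>-\<^sup>1\<parallel> \<parallel>P\<^sub>N V P\<^sub>N u\<parallel>\<close>, whose right-hand norm is at most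
  \<open>\<parallel>g\<parallel> + \<parallel>V\<parallel> \<parallel>u - P\<^sub>N u\<parallel>\<close>, bounds the lower limit. Projections enter only through best
  approximation, so their linearity up to null sets is never needed.\<close>

section \<open>Square-integrable functions\<close>

lemma L2_measurable: "f \<in> L2 M \<Longrightarrow> f \<in> borel_measurable M"
  by (simp add: L2_def)

lemma L2_square_integrable: "f \<in> L2 M \<Longrightarrow> integrable M (\<lambda>x. (cmod (f x))\<^sup>2)"
  by (simp add: L2_def)

lemma L2_zero: "(\<lambda>_. 0) \<in> L2 M"
  by (simp add: L2_def)

lemma L2_cmult:
  assumes "f \<in> L2 M"
  shows "(\<lambda>x. c * f x) \<in> L2 M"
  using assms by (auto simp: L2_def norm_mult power_mult_distrib)

lemma L2_add:
  assumes "f \<in> L2 M" "g \<in> L2 M"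
  shows "(\<lambda>x. f x + g x) \<in> L2 M"
proof -
  note [measurable] = L2_measurable[OF assms(1)] L2_measurable[OF assms(2)]
  have "(cmod (f x + g x))\<^sup>2 \<le> 2 * (cmod (f x))\<^sup>2 + 2 * (cmod (g x))\<^sup>2" for x
  proof -
    have "(cmod (f x + g x))\<^sup>2 \<le> (cmod (f x) + cmod (g x))\<^sup>2"
      by (intro power_mono norm_triangle_ineq) auto
    also have "\<dots> \<le> 2 * (cmod (f x))\<^sup>2 + 2 * (cmod (g x))\<^sup>2"
      using sum_squares_bound[of "cmod (f x)" "cmod (g x)"] by (simp add: power2_sum)
    finally show ?thesis .
  qed
  then have "integrable M (\<lambda>x. (cmod (f x + g x))\<^sup>2)"
    using assms
    by - (rule Bochner_Integration.integrable_bound[where f = "\<lambda>x. 2 * (cmod (f x))\<^sup>2 + 2 * (cmod (g x))\<^sup>2"],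
      auto simp: L2_square_integrable)
  then show ?thesis by (simp add: L2_def)
qed

lemma L2_diff:
  assumes "f \<in> L2 M" "g \<in> L2 M"
  shows "(\<lambda>x. f x - g x) \<in> L2 M"
  using L2_add[OF assms(1) L2_cmult[OF assms(2), of "-1"]] by simp

lemma L2_sum:
  assumes "\<And>i. i \<in> I \<Longrightarrow> f i \<in> L2 M"
  shows "(\<lambda>x. \<Sum>i\<in>I. f i x) \<in> L2 M"
  using assms by (induction I rule: infinite_finite_induct) (auto intro: L2_zero L2_add)

lemma L2_integrable_inner:
  assumes "f \<in> L2 M" "g \<in> L2 M"
  shows "integrable M (\<lambda>x. f x * cnj (g x))"
proof -
  note [measurable] = L2_measurable[OF assms(1)] L2_measurable[OF assms(2)]
  have "cmod (f x) * cmod (g x) \<le> (cmod (f x))\<^sup>2 + (cmod (g x))\<^sup>2" for x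
  proof -
    have "0 \<le> cmod (f x) * cmod (g x)" by simp
    then show ?thesis
      using sum_squares_bound[of "cmod (f x)" "cmod (g x)"] by linarith
  qed
  moreover have "(\<lambda>x. cnj (g x)) \<in> borel_measurable M"
    using borel_measurable_continuous_on[OF continuous_on_cnj[OF continuous_on_id] L2_measurable[OF assms(2)]] .
  ultimately show ?thesis
    using assms
    by - (rule Bochner_Integration.integrable_bound[where f = "\<lambda>x. (cmod (f x))\<^sup>2 + (cmod (g x))\<^sup>2"],
      auto simp: L2_square_integrable norm_mult)
qed

section \<open>Inner product and norm up to null sets\<close>

lemma L2_eq_sym: "L2_eq M f g \<Longrightarrow> L2_eq M g f"
  by (auto simp: L2_eq_def elim: eventually_mono)

lemma L2_norm_cong:
  assumes "f \<in> L2 M" "g \<in> L2 M" "L2_eq M f g"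
  shows "L2_norm M f = L2_norm M g"
proof -
  note [measurable] = L2_measurable[OF assms(1)] L2_measurable[OF assms(2)]
  have "integral\<^sup>L M (\<lambda>x. (cmod (f x))\<^sup>2) = integral\<^sup>L M (\<lambda>x. (cmod (g x))\<^sup>2)"
    using assms(3) by (intro integral_cong_AE) (auto simp: L2_eq_def elim: eventually_mono)
  then show ?thesis by (simp add: L2_norm_def)
qed

lemma L2_inner_cong:
  assumes "f \<in> L2 M" "g \<in> L2 M" "h \<in> L2 M" "L2_eq M f g"
  shows "L2_inner M f h = L2_inner M g h"
  unfolding L2_inner_def
  using assms(4) L2_integrable_inner[OF assms(1,3)] L2_integrable_inner[OF assms(2,3)]
  by (intro integral_cong_AE) (auto simp: L2_eq_def elim: eventually_mono)

lemma L2_inner_cmult_left: "L2_inner M (\<lambda>x. c * f x) h = c * L2_inner M f h"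
  by (simp add: L2_inner_def mult.assoc)

lemma L2_inner_commute: "L2_inner M f g = cnj (L2_inner M g f)"
proof -
  have "(\<lambda>x. f x * cnj (g x)) = (\<lambda>x. cnj (g x * cnj (f x)))"
    by (simp add: mult.commute)
  then show ?thesis
    unfolding L2_inner_def Bochner_Integration.integral_cnj[symmetric] by (rule arg_cong)
qed

lemma L2_inner_diff_left:
  assumes "f \<in> L2 M" "g \<in> L2 M" "h \<in> L2 M"
  shows "L2_inner M (\<lambda>x. f x - g x) h = L2_inner M f h - L2_inner M g h"
  using assms by (simp add: L2_inner_def L2_integrable_inner left_diff_distrib)

lemma L2_inner_sum_left:
  assumes "\<And>i. i \<in> I \<Longrightarrow> f i \<in> L2 M" "h \<in> L2 M"
  shows "L2_inner M (\<lambda>x. \<Sum>i\<in>I. f i x) h = (\<Sum>i\<in>I. L2_inner M (f i) h)"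
  using assms by (simp add: L2_inner_def L2_integrable_inner sum_distrib_right)

lemma L2_norm_nonneg: "0 \<le> L2_norm M f"
  by (simp add: L2_norm_def)

lemma L2_norm_square: "(L2_norm M f)\<^sup>2 = integral\<^sup>L M (\<lambda>x. (cmod (f x))\<^sup>2)"
  by (simp add: L2_norm_def)

lemma L2_inner_self: "L2_inner M f f = of_real ((L2_norm M f)\<^sup>2)"
  unfolding L2_norm_square L2_inner_def complex_norm_square integral_complex_of_real[symmetric] ..

lemma L2_norm_cmult: "L2_norm M (\<lambda>x. c * f x) = cmod c * L2_norm M f"
  by (simp add: L2_norm_def norm_mult power_mult_distrib real_sqrt_mult)

lemma L2_norm_diff_commute: "L2_norm M (\<lambda>x. f x - g x) = L2_norm M (\<lambda>x. g x - f x)"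
  by (simp add: L2_norm_def norm_minus_commute)

lemma L2_norm_add_square:
  assumes "f \<in> L2 M" "g \<in> L2 M"
  shows "(L2_norm M (\<lambda>x. f x + g x))\<^sup>2 =
    (L2_norm M f)\<^sup>2 + 2 * Re (L2_inner M f g) + (L2_norm M g)\<^sup>2"
proof -
  have "(cmod (f x + g x))\<^sup>2 = (cmod (f x))\<^sup>2 + 2 * Re (f x * cnj (g x)) + (cmod (g x))\<^sup>2" for x
    unfolding cmod_power2 by (simp add: power2_eq_square algebra_simps)
  \<comment> \<open>\<open>Re (f x * cnj (g x))\<close> has to stay unexpanded: it is the real part
    of an integrable function, while the products of components it splits into come without an
    integrability fact.\<close>
  then show ?thesis
    unfolding L2_norm_square
    using assms by (simp add: L2_inner_def L2_integrable_inner L2_square_integrable del: times_complex.sel)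
qed

lemma L2_norm_zero_AE:
  assumes "f \<in> L2 M" "L2_norm M f = 0"
  shows "L2_eq M f (\<lambda>_. 0)"
proof -
  have "integral\<^sup>L M (\<lambda>x. (cmod (f x))\<^sup>2) = 0"
    using assms(2) by (simp add: L2_norm_def)
  then have "AE x in M. (cmod (f x))\<^sup>2 = 0"
    using integral_nonneg_eq_0_iff_AE[OF L2_square_integrable[OF assms(1)]] by simp
  then show ?thesis by (simp add: L2_eq_def)
qed

text \<open>With a and b the norms of \<open>f\<close> and \<open>g\<close>, expand the nonnegative
  squared norm of b f - a g and cancel 2 a b. The real part is what the triangle inequality
  uses.\<close>

lemma L2_Cauchy_Schwarz_Re:
  assumes "f \<in> L2 M" "g \<in> L2 M"
  shows "Re (L2_inner M f g) \<le> L2_norm M f * L2_norm M g"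
proof (cases "L2_norm M f = 0 \<or> L2_norm M g = 0")
  case True
  \<comment> \<open>When a norm vanishes there is nothing to cancel; instead that function is null,
    so all its pairings vanish.\<close>
  have zero: "L2_inner M h k = 0" if "h \<in> L2 M" "k \<in> L2 M" "L2_norm M h = 0" for h k
    using L2_inner_cong[OF that(1) L2_zero that(2) L2_norm_zero_AE[OF that(1,3)]]
    by (simp add: L2_inner_def)
  from True have "L2_inner M f g = 0"
    using zero[of f g] zero[of g f] assms L2_inner_commute[of M f g] by auto
  then show ?thesis by (simp add: L2_norm_nonneg)
next
  case False
  define a b where "a = L2_norm M f" and "b = L2_norm M g"
  have pos: "a > 0" "b > 0"
    using False L2_norm_nonneg[of M] unfolding a_def b_def by (auto simp: less_le)
  have "Re (L2_inner M (\<lambda>x. of_real b * f x) (\<lambda>x. of_real (-a) * g x)) = - (a * b) * Re (L2_inner M f g)"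
    unfolding L2_inner_cmult_left
    by (subst L2_inner_commute, subst L2_inner_cmult_left, subst L2_inner_commute) simp
  then have "0 \<le> (b * a)\<^sup>2 + 2 * (- (a * b) * Re (L2_inner M f g)) + (a * b)\<^sup>2"
    using L2_norm_add_square[OF L2_cmult[OF assms(1), of "of_real b"] L2_cmult[OF assms(2), of "of_real (-a)"]]
      zero_le_power2[of "L2_norm M (\<lambda>x. of_real b * f x + of_real (-a) * g x)"] pos
    unfolding L2_norm_cmult by (simp add: a_def b_def)
  then have "(a * b) * Re (L2_inner M f g) \<le> (a * b) * (a * b)"
    by (simp add: power2_eq_square algebra_simps)
  then show ?thesis
    using pos unfolding a_def[symmetric] b_def[symmetric] by (simp only: mult_le_cancel_left_pos mult_pos_pos)
qed

lemma L2_norm_triangle: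
  assumes "f \<in> L2 M" "g \<in> L2 M"
  shows "L2_norm M (\<lambda>x. f x + g x) \<le> L2_norm M f + L2_norm M g"
proof (rule power2_le_imp_le)
  show "(L2_norm M (\<lambda>x. f x + g x))\<^sup>2 \<le> (L2_norm M f + L2_norm M g)\<^sup>2"
    unfolding L2_norm_add_square[OF assms] using L2_Cauchy_Schwarz_Re[OF assms]
    by (simp add: power2_sum)
qed (simp add: L2_norm_nonneg)

lemma L2_norm_triangle_diff:
  assumes "f \<in> L2 M" "g \<in> L2 M" "h \<in> L2 M"
  shows "L2_norm M (\<lambda>x. f x - h x) \<le> L2_norm M (\<lambda>x. f x - g x) + L2_norm M (\<lambda>x. g x - h x)"
  using L2_norm_triangle[OF L2_diff[OF assms(1,2)] L2_diff[OF assms(2,3)]] by simp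

lemma L2_norm_le_diff:
  assumes "f \<in> L2 M" "g \<in> L2 M"
  shows "L2_norm M f \<le> L2_norm M g + L2_norm M (\<lambda>x. f x - g x)"
  using L2_norm_triangle[OF assms(2) L2_diff[OF assms]] by simp

section \<open>Bounded operators and orthogonal projections\<close>

lemma L2_bounded_linear_in: "L2_bounded_linear M A \<Longrightarrow> f \<in> L2 M \<Longrightarrow> A f \<in> L2 M"
  by (simp add: L2_bounded_linear_def)

lemma L2_bounded_linear_cmult:
  "L2_bounded_linear M A \<Longrightarrow> f \<in> L2 M \<Longrightarrow> L2_eq M (A (\<lambda>x. c * f x)) (\<lambda>x. c * A f x)"
  by (simp add: L2_bounded_linear_def)

lemma L2_bounded_linear_add:
  "L2_bounded_linear M A \<Longrightarrow> f \<in> L2 M \<Longrightarrow> g \<in> L2 M \<Longrightarrow>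
    L2_eq M (A (\<lambda>x. f x + g x)) (\<lambda>x. A f x + A g x)"
  by (simp add: L2_bounded_linear_def)

lemma L2_bounded_linear_bound:
  assumes "L2_bounded_linear M A"
  obtains K where "K \<ge> 0" "\<And>f. f \<in> L2 M \<Longrightarrow> L2_norm M (A f) \<le> K * L2_norm M f"
proof -
  obtain K where K: "\<And>f. f \<in> L2 M \<Longrightarrow> L2_norm M (A f) \<le> K * L2_norm M f"
    using assms unfolding L2_bounded_linear_def by blast
  show ?thesis
  \<comment> \<open>The given \<open>K\<close> may be negative when every norm in the space is zero,
    hence the maximum with 0.\<close>
  proof (rule that[of "max K 0"])
    fix f assume "f \<in> L2 M"
    then show "L2_norm M (A f) \<le> max K 0 * L2_norm M f"
      using K[of f] mult_right_mono[of K "max K 0" "L2_norm M f"] L2_norm_nonneg[of M f] by simp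
  qed simp
qed

lemma L2_bounded_linear_diff:
  assumes "L2_bounded_linear M A" "f \<in> L2 M" "g \<in> L2 M"
  shows "L2_eq M (A (\<lambda>x. f x - g x)) (\<lambda>x. A f x - A g x)"
proof -
  have "AE x in M. A (\<lambda>x. f x + -1 * g x) x = A f x + A (\<lambda>x. -1 * g x) x"
    using L2_bounded_linear_add[OF assms(1,2) L2_cmult[OF assms(3), of "-1"]] by (simp only: L2_eq_def)
  moreover have "AE x in M. A (\<lambda>x. -1 * g x) x = -1 * A g x"
    using L2_bounded_linear_cmult[OF assms(1,3)] by (simp only: L2_eq_def)
  ultimately show ?thesis
    unfolding L2_eq_def by (elim AE_mp) (auto intro!: AE_I2)
qed

lemma L2_bounded_linear_sum:
  assumes "L2_bounded_linear M A" "\<And>i. i \<in> I \<Longrightarrow> f i \<in> L2 M" "finite I"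
  shows "L2_eq M (A (\<lambda>x. \<Sum>i\<in>I. c i * f i x)) (\<lambda>x. \<Sum>i\<in>I. c i * A (f i) x)"
  using assms(3,2)
proof (induction I)
  case empty
  show ?case
    using L2_bounded_linear_cmult[OF assms(1) L2_zero, of 0] by simp
next
  case (insert j I)
  have "AE x in M. A (\<lambda>x. c j * f j x + (\<Sum>i\<in>I. c i * f i x)) x
      = A (\<lambda>x. c j * f j x) x + A (\<lambda>x. \<Sum>i\<in>I. c i * f i x) x"
    using insert.prems L2_bounded_linear_add[OF assms(1)] by (simp add: L2_eq_def L2_cmult L2_sum)
  moreover have "AE x in M. A (\<lambda>x. c j * f j x) x = c j * A (f j) x"
    using insert.prems L2_bounded_linear_cmult[OF assms(1)] by (simp add: L2_eq_def)
  moreover have "AE x in M. A (\<lambda>x. \<Sum>i\<in>I. c i * f i x) x = (\<Sum>i\<in>I. c i * A (f i) x)"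
    using insert by (simp add: L2_eq_def)
  ultimately show ?case
    using insert.hyps unfolding L2_eq_def by (elim AE_mp) (auto intro!: AE_I2)
qed

section \<open>Operator norm and the chosen inverse\<close>

lemma L2_opnorm_upper:
  assumes "L2_bounded_linear M A" "f \<in> L2 M" "L2_norm M f \<le> 1"
  shows "L2_norm M (A f) \<le> L2_opnorm M A"
proof -
  obtain K where K: "K \<ge> 0" "\<And>f. f \<in> L2 M \<Longrightarrow> L2_norm M (A f) \<le> K * L2_norm M f"
    using L2_bounded_linear_bound[OF assms(1)] by blast
  \<comment> \<open>A real \<open>Sup\<close> is certain to be an upper bound only for a set bounded
    above; boundedness of \<open>A\<close> provides that.\<close>
  have "bdd_above {L2_norm M (A f) | f. f \<in> L2 M \<and> L2_norm M f \<le> 1}"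
  proof (rule bdd_aboveI, safe)
    fix g assume g: "g \<in> L2 M" "L2_norm M g \<le> 1"
    then show "L2_norm M (A g) \<le> K"
      using K(2)[OF g(1)] mult_left_mono[OF g(2) K(1)] by simp
  qed
  then show ?thesis
    unfolding L2_opnorm_def using assms(2,3) by (intro cSup_upper) auto
qed

lemma L2_opnorm_nonneg:
  assumes "L2_bounded_linear M A"
  shows "0 \<le> L2_opnorm M A"
  using order_trans[OF L2_norm_nonneg L2_opnorm_upper[OF assms L2_zero]] by (simp add: L2_norm_def)

lemma L2_norm_le_opnorm:
  assumes "L2_bounded_linear M A" "f \<in> L2 M"
  shows "L2_norm M (A f) \<le> L2_opnorm M A * L2_norm M f"
proof -
  obtain K where K: "K \<ge> 0" "\<And>f. f \<in> L2 M \<Longrightarrow> L2_norm M (A f) \<le> K * L2_norm M f"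
    using L2_bounded_linear_bound[OF assms(1)] by blast
  show ?thesis
  proof (cases "L2_norm M f = 0")
    \<comment> \<open>A null function cannot be rescaled to norm 1, so the crude constant
      \<open>K\<close> is used to see that its image has norm zero.\<close>
    case True
    then show ?thesis using K(2)[OF assms(2)] by simp
  next
    case False
    define c where "c = complex_of_real (1 / L2_norm M f)"
    have c: "cmod c = 1 / L2_norm M f"
      using L2_norm_nonneg[of M f] by (simp add: c_def norm_divide)
    have cf: "(\<lambda>x. c * f x) \<in> L2 M" by (rule L2_cmult[OF assms(2)])
    have "L2_norm M (\<lambda>x. c * f x) \<le> 1"
      using False by (simp add: L2_norm_cmult c)
    then have "L2_norm M (A (\<lambda>x. c * f x)) \<le> L2_opnorm M A"
      by (rule L2_opnorm_upper[OF assms(1) cf])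
    moreover have "L2_norm M (A (\<lambda>x. c * f x)) = cmod c * L2_norm M (A f)"
      unfolding L2_norm_cmult[symmetric]
      by (rule L2_norm_cong[OF L2_bounded_linear_in[OF assms(1) cf]
            L2_cmult[OF L2_bounded_linear_in[OF assms]] L2_bounded_linear_cmult[OF assms]])
    ultimately show ?thesis
      using False L2_norm_nonneg[of M f] by (simp add: c field_simps)
  qed
qed

lemma less_L2_opnormD:
  assumes "a < L2_opnorm M A"
  shows "\<exists>f\<in>L2 M. L2_norm M f \<le> 1 \<and> a < L2_norm M (A f)"
proof (rule ccontr)
  assume "\<not> ?thesis"
  then have "L2_opnorm M A \<le> a"
    unfolding L2_opnorm_def
    by (intro cSup_least) (auto intro!: exI[of _ "\<lambda>_. 0"] simp: L2_zero L2_norm_def not_less)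
  then show False using assms by simp
qed

lemma L2_inverts_L2_inv: "L2_invertible M A \<Longrightarrow> L2_inverts M A (L2_inv M A)"
  unfolding L2_invertible_def L2_inv_def by (elim exE) (rule someI[of "L2_inverts M A"])

section \<open>Subspaces and orthogonal projections\<close>

lemma L2_subspace_add:
  "L2_subspace M X \<Longrightarrow> f \<in> X \<Longrightarrow> g \<in> X \<Longrightarrow> (\<lambda>x. f x + g x) \<in> X"
  by (simp add: L2_subspace_def)

lemma L2_subspace_cmult: "L2_subspace M X \<Longrightarrow> f \<in> X \<Longrightarrow> (\<lambda>x. c * f x) \<in> X"
  by (simp add: L2_subspace_def)

lemma L2_subspace_sum:
  assumes "L2_subspace M X" "\<And>i. i \<in> I \<Longrightarrow> f i \<in> X"
  shows "(\<lambda>x. \<Sum>i\<in>I. f i x) \<in> X"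
  using assms(2)
proof (induction I rule: infinite_finite_induct)
  case (insert i I)
  then show ?case using L2_subspace_add[OF assms(1)] by simp
qed (use assms(1) in \<open>simp_all add: L2_subspace_def\<close>)

text \<open>Best approximation by Pythagoras: \<open>P f - h\<close> lies in \<open>X\<close>, hence
  is orthogonal to \<open>f - P f\<close>, and the two add up to \<open>f - h\<close>.\<close>

lemma L2_orthogonal_projection_le:
  assumes "L2_subspace M X" "L2_orthogonal_projection M X P" "f \<in> L2 M" "h \<in> X"
  shows "L2_norm M (\<lambda>x. P f x - f x) \<le> L2_norm M (\<lambda>x. h x - f x)"
proof -
  have X: "P f \<in> X" "X \<subseteq> L2 M"
    using assms by (auto simp: L2_orthogonal_projection_def L2_subspace_def)
  have "(\<lambda>x. P f x + -1 * h x) \<in> X"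
    by (rule L2_subspace_add[OF assms(1) X(1) L2_subspace_cmult[OF assms(1,4)]])
  then have d: "(\<lambda>x. P f x - h x) \<in> X" by simp
  have "L2_inner M (\<lambda>x. f x - P f x) (\<lambda>x. P f x - h x) = 0"
    using assms d by (simp add: L2_orthogonal_projection_def)
  then have "(L2_norm M (\<lambda>x. f x - h x))\<^sup>2 =
      (L2_norm M (\<lambda>x. f x - P f x))\<^sup>2 + (L2_norm M (\<lambda>x. P f x - h x))\<^sup>2"
    using L2_norm_add_square[of "\<lambda>x. f x - P f x" M "\<lambda>x. P f x - h x"] assms X d
    by (simp add: L2_diff subset_eq)
  then have "(L2_norm M (\<lambda>x. f x - P f x))\<^sup>2 \<le> (L2_norm M (\<lambda>x. f x - h x))\<^sup>2"
    by simp
  then show ?thesis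
    unfolding L2_norm_diff_commute[of M _ f] by (rule power2_le_imp_le) (rule L2_norm_nonneg)
qed

lemma L2_norm_orthogonal_projection_le:
  assumes "L2_subspace M X" "L2_orthogonal_projection M X P" "f \<in> L2 M"
  shows "L2_norm M (P f) \<le> L2_norm M f"
proof -
  have X: "P f \<in> X" "P f \<in> L2 M"
    using assms by (auto simp: L2_orthogonal_projection_def L2_subspace_def)
  have "L2_inner M (\<lambda>x. f x - P f x) (P f) = 0"
    using assms X by (simp add: L2_orthogonal_projection_def)
  then have "(L2_norm M f)\<^sup>2 = (L2_norm M (\<lambda>x. f x - P f x))\<^sup>2 + (L2_norm M (P f))\<^sup>2"
    using L2_norm_add_square[OF L2_diff[OF assms(3) X(2)] X(2)] by simp
  then have "(L2_norm M (P f))\<^sup>2 \<le> (L2_norm M f)\<^sup>2" by simp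
  then show ?thesis by (rule power2_le_imp_le) (rule L2_norm_nonneg)
qed

text \<open>Pointwise convergence of the projections becomes uniform on a relatively compact set,
  here the image of the unit ball under \<open>C\<close>. This is where compactness enters. A
  sequence of counterexamples would have images under \<open>C\<close> accumulating at one point,
  where the projections do converge.\<close>

lemma L2_compact_projection_uniform:
  assumes C: "L2_compact M C"
    and X: "\<And>N. N \<ge> 1 \<Longrightarrow> L2_subspace M (X N)"
    and P: "\<And>N. N \<ge> 1 \<Longrightarrow> L2_orthogonal_projection M (X N) (P N)"
    and lim: "\<And>f. f \<in> L2 M \<Longrightarrow> (\<lambda>N. L2_norm M (\<lambda>x. P N f x - f x)) \<longlonglongrightarrow> 0"
    and "\<delta> > 0"
  shows "\<forall>\<^sub>F N in sequentially. \<forall>f\<in>L2 M. L2_norm M (\<lambda>x. P N (C f) x - C f x) \<le> \<delta> * L2_norm M f"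
proof -
  have lin: "L2_bounded_linear M C" using C by (simp add: L2_compact_def)
  have PX: "P N f \<in> X N" "P N f \<in> L2 M" if "N \<ge> 1" "f \<in> L2 M" for N f
    using X[OF that(1)] P[OF that(1)] that(2)
    by (auto simp: L2_orthogonal_projection_def L2_subspace_def)
  \<comment> \<open>The guard \<open>N \<ge> 1\<close> restricts counterexamples to indices for
    which \<open>X N\<close> and \<open>P N\<close> are known to be a subspace and its
    projection.\<close>
  have "\<forall>\<^sub>F N in sequentially. N \<ge> 1 \<longrightarrow>
      (\<forall>f\<in>L2 M. L2_norm M f \<le> 1 \<longrightarrow> L2_norm M (\<lambda>x. P N (C f) x - C f x) \<le> \<delta>)"
  proof (rule ccontr)
    assume "\<not> ?thesis"
    from not_eventually_sequentiallyD[OF this] obtain r :: "nat \<Rightarrow> nat" where r: "strict_mono r"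
      "\<forall>n. \<not> (r n \<ge> 1 \<longrightarrow> (\<forall>f\<in>L2 M. L2_norm M f \<le> 1 \<longrightarrow>
        L2_norm M (\<lambda>x. P (r n) (C f) x - C f x) \<le> \<delta>))"
      by blast
    then have "\<forall>n. \<exists>f. f \<in> L2 M \<and> L2_norm M f \<le> 1 \<and> r n \<ge> 1 \<and>
        \<delta> < L2_norm M (\<lambda>x. P (r n) (C f) x - C f x)"
      by (auto simp: not_le)
    then obtain f where f: "\<And>n. f n \<in> L2 M" "\<And>n. L2_norm M (f n) \<le> 1" "\<And>n. r n \<ge> 1"
      "\<And>n. \<delta> < L2_norm M (\<lambda>x. P (r n) (C (f n)) x - C (f n) x)"
      by metis
    obtain g s where g: "g \<in> L2 M" and s: "strict_mono (s :: nat \<Rightarrow> nat)"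
      and conv: "(\<lambda>n. L2_norm M (\<lambda>x. C (f (s n)) x - g x)) \<longlonglongrightarrow> 0"
      using C f(1,2) unfolding L2_compact_def by meson
    have "strict_mono (r \<circ> s)" using r(1) s by (rule strict_mono_o)
    from LIMSEQ_subseq_LIMSEQ[OF lim[OF g] this]
    have "(\<lambda>n. L2_norm M (\<lambda>x. P (r (s n)) g x - g x) + L2_norm M (\<lambda>x. C (f (s n)) x - g x)) \<longlonglongrightarrow> 0"
      using tendsto_add[OF _ conv, of _ 0] by (simp add: o_def)
    then have "\<forall>\<^sub>F n in sequentially.
        L2_norm M (\<lambda>x. P (r (s n)) g x - g x) + L2_norm M (\<lambda>x. C (f (s n)) x - g x) < \<delta>"
      using \<open>\<delta> > 0\<close> by (rule order_tendstoD)
    then obtain n where n: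
      "L2_norm M (\<lambda>x. P (r (s n)) g x - g x) + L2_norm M (\<lambda>x. C (f (s n)) x - g x) < \<delta>"
      using eventually_happens[of _ sequentially] by fastforce
    define N h where "N = r (s n)" and "h = C (f (s n))"
    have N: "N \<ge> 1" and h: "h \<in> L2 M"
      using f lin by (auto simp: N_def h_def L2_bounded_linear_in)
    \<comment> \<open>\<open>P N g\<close> lies in \<open>X N\<close>, so it competes with the best
      approximation \<open>P N h\<close>; this comparison replaces linearity of
      \<open>P N\<close>.\<close>
    have "L2_norm M (\<lambda>x. P N h x - h x) \<le> L2_norm M (\<lambda>x. P N g x - h x)"
      using L2_orthogonal_projection_le[OF X[OF N] P[OF N] h] PX[OF N g] by blast
    also have "\<dots> \<le> L2_norm M (\<lambda>x. P N g x - g x) + L2_norm M (\<lambda>x. h x - g x)"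
      using L2_norm_triangle_diff[OF PX(2)[OF N g] g h] L2_norm_diff_commute[of M g h] by simp
    also have "\<dots> < \<delta>" using n by (simp add: N_def h_def)
    finally show False using f(4)[of "s n"] by (simp add: N_def h_def)
  qed
  with eventually_ge_at_top[of 1] show ?thesis
  proof eventually_elim
    case (elim N)
    then have N: "N \<ge> 1" by simp
    have unit: "L2_norm M (\<lambda>x. P N (C f) x - C f x) \<le> \<delta>" if "f \<in> L2 M" "L2_norm M f \<le> 1" for f
      using elim that by simp
    show ?case
    proof
      fix f assume f: "f \<in> L2 M"
      define h where "h = C f"
      have h: "h \<in> L2 M" using f lin by (simp add: h_def L2_bounded_linear_in)
      show "L2_norm M (\<lambda>x. P N (C f) x - C f x) \<le> \<delta> * L2_norm M f"
      proof (cases "L2_norm M f = 0")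
        case True
        \<comment> \<open>A null \<open>f\<close> cannot be normalised; comparison with 0 bounds the
          error by the norm of \<open>C f\<close>, which is zero.\<close>
        have "(\<lambda>_. 0) \<in> X N" using X[OF N] by (simp add: L2_subspace_def)
        from L2_orthogonal_projection_le[OF X[OF N] P[OF N] h this]
        have "L2_norm M (\<lambda>x. P N h x - h x) \<le> L2_norm M h"
          by (simp add: L2_norm_def)
        also have "\<dots> \<le> L2_opnorm M C * L2_norm M f"
          unfolding h_def by (rule L2_norm_le_opnorm[OF lin f])
        finally show ?thesis using True by (simp add: h_def)
      next
        case False
        \<comment> \<open>\<open>c\<close> normalises \<open>f\<close> and \<open>d\<close> undoes
          it. With \<open>k\<close> the image of the normalised function, \<open>d * P N k\<close>
          competes with \<open>P N h\<close>, and its error is \<open>t\<close> times one already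
          bounded by \<delta>.\<close>
        define t c d where "t = L2_norm M f" and "c = complex_of_real (1 / t)" and "d = complex_of_real t"
        have t: "t > 0" using False L2_norm_nonneg[of M f] by (simp add: t_def)
        have c: "cmod c = 1 / t" "cmod d = t" "d * c = 1"
          using t by (simp_all add: c_def d_def norm_divide)
        define k where "k = C (\<lambda>x. c * f x)"
        have k: "k \<in> L2 M" using f lin by (simp add: k_def L2_bounded_linear_in L2_cmult)
        have "L2_norm M (\<lambda>x. P N h x - h x) \<le> L2_norm M (\<lambda>x. d * P N k x - h x)"
          using X[OF N] PX(1)[OF N k]
          by (intro L2_orthogonal_projection_le[OF X[OF N] P[OF N] h]) (simp add: L2_subspace_def)
        also have "\<dots> = L2_norm M (\<lambda>x. d * (P N k x - k x))"
        proof (rule L2_norm_cong)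
          have "L2_eq M k (\<lambda>x. c * h x)"
            unfolding k_def h_def by (rule L2_bounded_linear_cmult[OF lin f])
          then show "L2_eq M (\<lambda>x. d * P N k x - h x) (\<lambda>x. d * (P N k x - k x))"
            unfolding L2_eq_def
            by (elim eventually_mono)
              (simp add: right_diff_distrib mult.assoc[symmetric] c(3))
        qed (intro L2_diff L2_cmult PX(2)[OF N] h k)+
        also have "\<dots> = t * L2_norm M (\<lambda>x. P N k x - k x)"
          by (simp only: L2_norm_cmult c)
        also have "\<dots> \<le> t * \<delta>"
          unfolding k_def using t f
          by (intro mult_left_mono unit L2_cmult) (auto simp: L2_norm_cmult c t_def)
        finally show ?thesis by (simp add: h_def t_def mult.commute)
      qed
    qed
  qed
qed

section \<open>Matrices bounded below and the Galerkin matrix\<close>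

lemma euclidean_vec_norm_nonneg: "0 \<le> euclidean_vec_norm v"
  by (simp add: euclidean_vec_norm_def sum_nonneg)

lemma euclidean_vec_norm_eq_0:
  assumes "v \<in> carrier_vec n" "euclidean_vec_norm v = 0"
  shows "v = 0\<^sub>v n"
proof -
  have "(\<Sum>i<dim_vec v. (cmod (vec_index v i))\<^sup>2) = 0"
    using assms(2) by (simp add: euclidean_vec_norm_def)
  then have "\<forall>i<dim_vec v. vec_index v i = 0"
    by (subst (asm) sum_nonneg_eq_0_iff) auto
  then show ?thesis using assms(1) by (intro eq_vecI) auto
qed

lemma euclidean_vec_norm_zero: "euclidean_vec_norm (0\<^sub>v n) = 0"
  by (simp add: euclidean_vec_norm_def)

lemma euclidean_vec_norm_smult: "euclidean_vec_norm (c \<cdot>\<^sub>v v) = cmod c * euclidean_vec_norm v"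
  by (simp add: euclidean_vec_norm_def norm_mult power_mult_distrib sum_distrib_left[symmetric]
      real_sqrt_mult)

text \<open>The bound \<open>a\<close> serves twice: it caps \<open>mat_norm A\<close>, and it makes
  the set under the \<open>Sup\<close> bounded above, so that the supremum is a true operator norm.
  The zero vector keeps that set nonempty, also for n = 0.\<close>

lemma
  fixes A :: "complex mat"
  assumes A: "A \<in> carrier_mat n n" and "a \<ge> 0"
    and bound: "\<And>v. v \<in> carrier_vec n \<Longrightarrow> euclidean_vec_norm (A *\<^sub>v v) \<le> a * euclidean_vec_norm v"
  shows mat_norm_le: "mat_norm A \<le> a"
    and mat_norm_nonneg: "0 \<le> mat_norm A"
    and euclidean_vec_norm_mult_le:
      "v \<in> carrier_vec n \<Longrightarrow> euclidean_vec_norm (A *\<^sub>v v) \<le> mat_norm A * euclidean_vec_norm v"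
proof -
  let ?S = "{euclidean_vec_norm (A *\<^sub>v v) | v. v \<in> carrier_vec (dim_col A) \<and> euclidean_vec_norm v \<le> 1}"
  have le: "x \<le> a" if "x \<in> ?S" for x
  proof -
    from that A obtain v where v: "x = euclidean_vec_norm (A *\<^sub>v v)" "v \<in> carrier_vec n"
      "euclidean_vec_norm v \<le> 1" by auto
    then show ?thesis using bound[OF v(2)] mult_left_mono[OF v(3) \<open>a \<ge> 0\<close>] by simp
  qed
  have zero: "euclidean_vec_norm (A *\<^sub>v 0\<^sub>v n) \<in> ?S"
    using A by (auto intro!: exI[of _ "0\<^sub>v n"] simp: euclidean_vec_norm_zero)
  then show "mat_norm A \<le> a"
    unfolding mat_norm_def using le by (intro cSup_least) auto
  have "euclidean_vec_norm (A *\<^sub>v 0\<^sub>v n) \<le> mat_norm A"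
    unfolding mat_norm_def using zero le by (intro cSup_upper bdd_aboveI) auto
  then show "0 \<le> mat_norm A"
    using euclidean_vec_norm_nonneg order_trans by blast
  show "euclidean_vec_norm (A *\<^sub>v v) \<le> mat_norm A * euclidean_vec_norm v" if v: "v \<in> carrier_vec n"
  proof (cases "euclidean_vec_norm v = 0")
    case True
    then show ?thesis using bound[OF v] by simp
  next
    case False
    define c where "c = complex_of_real (1 / euclidean_vec_norm v)"
    have c: "cmod c = 1 / euclidean_vec_norm v"
      using euclidean_vec_norm_nonneg[of v] by (simp add: c_def norm_divide)
    have "euclidean_vec_norm (A *\<^sub>v (c \<cdot>\<^sub>v v)) \<in> ?S"
      using A v False by (auto intro!: exI[of _ "c \<cdot>\<^sub>v v"] simp: euclidean_vec_norm_smult c)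
    then have "euclidean_vec_norm (A *\<^sub>v (c \<cdot>\<^sub>v v)) \<le> mat_norm A"
      unfolding mat_norm_def using le by (intro cSup_upper bdd_aboveI) auto
    then show ?thesis
      using False euclidean_vec_norm_nonneg[of v]
      by (simp add: mult_mat_vec[OF A v] euclidean_vec_norm_smult c field_simps)
  qed
qed

text \<open>Boundedness below forces a trivial kernel, which for a square matrix means a nonzero
  determinant and hence an inverse. Applied to the image of a vector under the inverse, the same
  estimate becomes an upper bound for the inverse.\<close>

lemma
  fixes G :: "complex mat"
  assumes G: "G \<in> carrier_mat n n" and "a \<ge> 0"
    and bound: "\<And>v. v \<in> carrier_vec n \<Longrightarrow> euclidean_vec_norm v \<le> a * euclidean_vec_norm (G *\<^sub>v v)"
  shows invertible_mat_of_bounded_below: "invertible_mat G"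
    and mat_norm_inverse_le: "mat_norm (the (mat_inverse G)) \<le> a"
    and mat_norm_inverse_nonneg: "0 \<le> mat_norm (the (mat_inverse G))"
    and euclidean_vec_norm_le_inverse: "v \<in> carrier_vec n \<Longrightarrow>
      euclidean_vec_norm v \<le> mat_norm (the (mat_inverse G)) * euclidean_vec_norm (G *\<^sub>v v)"
proof -
  have "det G \<noteq> 0"
  proof
    assume "det G = 0"
    then obtain v where v: "v \<in> carrier_vec n" "v \<noteq> 0\<^sub>v n" "G *\<^sub>v v = 0\<^sub>v n"
      using det_0_iff_vec_prod_zero_field[OF G] by blast
    have "euclidean_vec_norm v = 0"
      using bound[OF v(1)] euclidean_vec_norm_nonneg[of v] v(3) by (simp add: euclidean_vec_norm_zero)
    then show False using euclidean_vec_norm_eq_0[OF v(1)] v(2) by simp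
  qed
  then have "G \<in> Units (ring_mat TYPE(complex) n ())"
    by (rule det_non_zero_imp_unit[OF G])
  \<comment> \<open>\<open>mat_inverse\<close> never returns \<open>None\<close> on a unit of the
    matrix ring, so \<open>the\<close> yields the actual inverse.\<close>
  then obtain H where H: "mat_inverse G = Some H"
    using mat_inverse(1)[OF G, of "()"] by (cases "mat_inverse G") auto
  then have inv: "G * H = 1\<^sub>m n" "H * G = 1\<^sub>m n" "H \<in> carrier_mat n n"
    using mat_inverse(2)[OF G H] by auto
  show "invertible_mat G"
    unfolding invertible_mat_def inverts_mat_def
    using G inv by (intro conjI exI[of _ H]) auto
  have HG: "H *\<^sub>v (G *\<^sub>v v) = v" "G *\<^sub>v (H *\<^sub>v v) = v" if "v \<in> carrier_vec n" for v
    using that G inv by (simp_all flip: assoc_mult_mat_vec)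
  have Hb: "euclidean_vec_norm (H *\<^sub>v v) \<le> a * euclidean_vec_norm v" if "v \<in> carrier_vec n" for v
    using bound[of "H *\<^sub>v v"] HG(2)[OF that] that inv(3) by simp
  show "mat_norm (the (mat_inverse G)) \<le> a"
    using mat_norm_le[OF inv(3) \<open>a \<ge> 0\<close> Hb] H by simp
  show "0 \<le> mat_norm (the (mat_inverse G))"
    using mat_norm_nonneg[OF inv(3) \<open>a \<ge> 0\<close> Hb] H by simp
  show "euclidean_vec_norm v \<le> mat_norm (the (mat_inverse G)) * euclidean_vec_norm (G *\<^sub>v v)"
    if v: "v \<in> carrier_vec n"
    using euclidean_vec_norm_mult_le[OF inv(3) \<open>a \<ge> 0\<close> Hb, of "G *\<^sub>v v"] H HG(1)[OF v] G v by simp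
qed

section \<open>Coordinates in an orthonormal basis\<close>

lemma L2_orthonormal_basisD:
  assumes "L2_subspace M X" "L2_orthonormal_basis M X bs" "i < length bs"
  shows "bs ! i \<in> X" "bs ! i \<in> L2 M"
proof -
  show "bs ! i \<in> X"
    using assms(2) nth_mem[OF assms(3)] by (auto simp: L2_orthonormal_basis_def L2_spans_def)
  then show "bs ! i \<in> L2 M"
    using assms(1) by (auto simp: L2_subspace_def)
qed

lemma L2_orthonormal_basis_combination:
  assumes "L2_subspace M X" "L2_orthonormal_basis M X bs"
  shows "(\<lambda>x. \<Sum>i<length bs. c i * (bs ! i) x) \<in> X" "(\<lambda>x. \<Sum>i<length bs. c i * (bs ! i) x) \<in> L2 M"
proof -
  show "(\<lambda>x. \<Sum>i<length bs. c i * (bs ! i) x) \<in> X"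
    using L2_orthonormal_basisD(1)[OF assms]
    by (intro L2_subspace_sum[OF assms(1)] L2_subspace_cmult[OF assms(1)]) simp
  then show "(\<lambda>x. \<Sum>i<length bs. c i * (bs ! i) x) \<in> L2 M"
    using assms(1) by (auto simp: L2_subspace_def)
qed

lemma L2_inner_combination_left:
  assumes "L2_subspace M X" "L2_orthonormal_basis M X bs" "h \<in> L2 M"
  shows "L2_inner M (\<lambda>x. \<Sum>i<length bs. c i * (bs ! i) x) h = (\<Sum>i<length bs. c i * L2_inner M (bs ! i) h)"
  using L2_orthonormal_basisD(2)[OF assms(1,2)] assms(3)
  by (subst L2_inner_sum_left) (auto intro: L2_cmult simp: L2_inner_cmult_left)

lemma L2_inner_combination_basis:
  assumes "L2_subspace M X" "L2_orthonormal_basis M X bs" "k < length bs"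
  shows "L2_inner M (\<lambda>x. \<Sum>i<length bs. c i * (bs ! i) x) (bs ! k) = c k"
proof -
  have "c i * L2_inner M (bs ! i) (bs ! k) = (if i = k then c i else 0)" if "i < length bs" for i
    using assms(2,3) that by (simp add: L2_orthonormal_basis_def)
  then show ?thesis
    using assms(3) unfolding L2_inner_combination_left[OF assms(1,2) L2_orthonormal_basisD(2)[OF assms]]
    by simp
qed

text \<open>Parseval's identity: pairing the combination with the \<open>i\<close>-th basis function
  returns \<open>c i\<close>, so the double sum collapses to its diagonal.\<close>

lemma L2_norm_combination:
  assumes "L2_subspace M X" "L2_orthonormal_basis M X bs"
  shows "L2_norm M (\<lambda>x. \<Sum>i<length bs. c i * (bs ! i) x) = sqrt (\<Sum>i<length bs. (cmod (c i))\<^sup>2)"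
proof -
  let ?f = "\<lambda>x. \<Sum>i<length bs. c i * (bs ! i) x"
  have "L2_inner M (bs ! i) ?f = cnj (c i)" if "i < length bs" for i
    by (subst L2_inner_commute) (simp add: L2_inner_combination_basis[OF assms that])
  then have "complex_of_real ((L2_norm M ?f)\<^sup>2) = (\<Sum>i<length bs. c i * cnj (c i))"
    unfolding L2_inner_self[symmetric]
      L2_inner_combination_left[OF assms L2_orthonormal_basis_combination(2)[OF assms]]
    by simp
  also have "\<dots> = complex_of_real (\<Sum>i<length bs. (cmod (c i))\<^sup>2)"
    by (simp add: complex_norm_square[symmetric])
  finally have "(L2_norm M ?f)\<^sup>2 = (\<Sum>i<length bs. (cmod (c i))\<^sup>2)"
    by (simp only: of_real_eq_iff)
  then show ?thesis
    by (metis L2_norm_nonneg real_sqrt_unique)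
qed

text \<open>\<open>f - P f\<close> is orthogonal to every basis function, so the coordinates of
  \<open>P f\<close> are the pairings of \<open>f\<close> with the basis, and Parseval's identity
  applies.\<close>

lemma L2_norm_projection_eq:
  assumes X: "L2_subspace M X" and P: "L2_orthogonal_projection M X P"
    and B: "L2_orthonormal_basis M X bs" and f: "f \<in> L2 M"
  shows "L2_norm M (P f) = sqrt (\<Sum>i<length bs. (cmod (L2_inner M f (bs ! i)))\<^sup>2)"
proof -
  have Pf: "P f \<in> X" "P f \<in> L2 M"
    using X P f by (auto simp: L2_orthogonal_projection_def L2_subspace_def)
  obtain c where c: "L2_eq M (P f) (\<lambda>x. \<Sum>i<length bs. c i * (bs ! i) x)"
    using B Pf(1) by (auto simp: L2_orthonormal_basis_def L2_spans_def)
  have "c k = L2_inner M f (bs ! k)" if k: "k < length bs" for k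
  proof -
    note bk = L2_orthonormal_basisD[OF X B k]
    have "0 = L2_inner M (\<lambda>x. f x - P f x) (bs ! k)"
      using P f bk by (simp add: L2_orthogonal_projection_def)
    also have "\<dots> = L2_inner M f (bs ! k) - L2_inner M (P f) (bs ! k)"
      by (rule L2_inner_diff_left[OF f Pf(2) bk(2)])
    also have "L2_inner M (P f) (bs ! k) = c k"
      using L2_inner_cong[OF Pf(2) L2_orthonormal_basis_combination(2)[OF X B] bk(2) c]
        L2_inner_combination_basis[OF X B k] by simp
    finally show ?thesis by simp
  qed
  then show ?thesis
    using L2_norm_cong[OF Pf(2) L2_orthonormal_basis_combination(2)[OF X B] c]
    by (simp add: L2_norm_combination[OF X B])
qed

text \<open>Let f have coordinates \<open>v\<close>. By linearity, entry \<open>i\<close> of the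
  product is the inner product of A f with the \<open>i\<close>-th basis function, which is the
  \<open>i\<close>-th coordinate of P (A f). The matrix is thus the compression of \<open>A\<close>
  to \<open>X\<close> in isometric coordinates.\<close>

lemma euclidean_vec_norm_galerkin:
  assumes A: "L2_bounded_linear M A" and X: "L2_subspace M X"
    and P: "L2_orthogonal_projection M X P" and B: "L2_orthonormal_basis M X bs"
    and v: "v \<in> carrier_vec (length bs)"
  shows "euclidean_vec_norm (galerkin_matrix M A bs *\<^sub>v v) =
    L2_norm M (P (A (\<lambda>x. \<Sum>i<length bs. vec_index v i * (bs ! i) x)))"
proof -
  let ?f = "\<lambda>x. \<Sum>i<length bs. vec_index v i * (bs ! i) x"
  note bs = L2_orthonormal_basisD(2)[OF X B]
  have Af: "A ?f \<in> L2 M"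
    using L2_bounded_linear_in[OF A L2_orthonormal_basis_combination(2)[OF X B]] .
  have "vec_index (galerkin_matrix M A bs *\<^sub>v v) i = L2_inner M (A ?f) (bs ! i)" if i: "i < length bs" for i
  proof -
    have Abs: "(\<lambda>x. vec_index v j * A (bs ! j) x) \<in> L2 M" if "j < length bs" for j
      by (intro L2_cmult L2_bounded_linear_in[OF A] bs that)
    have "L2_inner M (A ?f) (bs ! i)
        = L2_inner M (\<lambda>x. \<Sum>j<length bs. vec_index v j * A (bs ! j) x) (bs ! i)"
      using bs Abs by (intro L2_inner_cong[OF Af _ bs[OF i]] L2_bounded_linear_sum[OF A] L2_sum) auto
    also have "\<dots> = (\<Sum>j<length bs. vec_index v j * L2_inner M (A (bs ! j)) (bs ! i))"
      using Abs bs[OF i] by (subst L2_inner_sum_left) (auto simp: L2_inner_cmult_left)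
    finally show ?thesis
      using i v by (simp add: galerkin_matrix_def scalar_prod_def atLeast0LessThan mult.commute)
  qed
  then show ?thesis
    unfolding L2_norm_projection_eq[OF X P B Af]
    by (simp add: euclidean_vec_norm_def galerkin_matrix_def)
qed

lemma euclidean_vec_norm_combination:
  assumes "L2_subspace M X" "L2_orthonormal_basis M X bs" "v \<in> carrier_vec (length bs)"
  shows "euclidean_vec_norm v = L2_norm M (\<lambda>x. \<Sum>i<length bs. vec_index v i * (bs ! i) x)"
  using assms(3) by (simp add: L2_norm_combination[OF assms(1,2)] euclidean_vec_norm_def)

section \<open>Stability and convergence of the Galerkin matrices\<close>

text \<open>Let w be the norm of \<open>W\<close> and f the function with coordinates
  \<open>v\<close>. Then |f| \<le> w |V f| \<le> w (|P V f| + \<delta> |f|), and the last term is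
  absorbed on the left since \<delta> w < 1. The condition on \<open>a\<close> is w / (1 - \<delta>
  w) \<le> a, cleared of the denominator.\<close>

lemma galerkin_bounded_below:
  assumes V: "L2_bounded_linear M V" and C: "L2_bounded_linear M C"
    and VC: "\<And>f. f \<in> L2 M \<Longrightarrow> L2_eq M (V f) (\<lambda>x. f x + C f x)"
    and W: "L2_inverts M V W"
    and X: "L2_subspace M X" and P: "L2_orthogonal_projection M X P"
    and B: "L2_orthonormal_basis M X bs"
    and \<delta>: "\<And>f. f \<in> L2 M \<Longrightarrow> L2_norm M (\<lambda>x. P (C f) x - C f x) \<le> \<delta> * L2_norm M f"
    and a: "a \<ge> 0" "\<delta> * L2_opnorm M W < 1" "L2_opnorm M W \<le> a * (1 - \<delta> * L2_opnorm M W)"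
    and v: "v \<in> carrier_vec (length bs)"
  shows "euclidean_vec_norm v \<le> a * euclidean_vec_norm (galerkin_matrix M V bs *\<^sub>v v)"
proof -
  define f where "f = (\<lambda>x. \<Sum>i<length bs. vec_index v i * (bs ! i) x)"
  define w where "w = L2_opnorm M W"
  have Wlin: "L2_bounded_linear M W" using W by (simp add: L2_inverts_def)
  have f: "f \<in> X" "f \<in> L2 M"
    unfolding f_def by (rule L2_orthonormal_basis_combination[OF X B])+
  have Vf: "V f \<in> L2 M" and Cf: "C f \<in> L2 M"
    using f V C by (simp_all add: L2_bounded_linear_in)
  have PX: "P h \<in> X" "P h \<in> L2 M" if "h \<in> L2 M" for h
    using X P that by (auto simp: L2_orthogonal_projection_def L2_subspace_def)
  have "L2_norm M f = L2_norm M (W (V f))"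
    using W f(2) Vf Wlin
    by (intro L2_norm_cong L2_eq_sym[of _ "W (V f)"]) (simp_all add: L2_inverts_def L2_bounded_linear_in)
  also have "\<dots> \<le> w * L2_norm M (V f)"
    unfolding w_def by (rule L2_norm_le_opnorm[OF Wlin Vf])
  finally have 1: "L2_norm M f \<le> w * L2_norm M (V f)" .
  \<comment> \<open>As \<open>f\<close> lies in \<open>X\<close>, so does
    \<open>f + P (C f)\<close>, which therefore competes with the best approximation
    \<open>P (V f)\<close>. Since V f = f + C f, its error is that of \<open>P (C f)\<close> against
    \<open>C f\<close>.\<close>
  have "L2_norm M (\<lambda>x. P (V f) x - V f x) \<le> L2_norm M (\<lambda>x. (f x + P (C f) x) - V f x)"
    by (rule L2_orthogonal_projection_le[OF X P Vf L2_subspace_add[OF X f(1) PX(1)[OF Cf]]])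
  also have "\<dots> = L2_norm M (\<lambda>x. P (C f) x - C f x)"
    using VC[OF f(2)]
    by (intro L2_norm_cong L2_diff L2_add f Vf Cf PX) (auto simp: L2_eq_def elim: eventually_mono)
  also have "\<dots> \<le> \<delta> * L2_norm M f" by (rule \<delta>[OF f(2)])
  finally have "L2_norm M (V f) \<le> L2_norm M (P (V f)) + \<delta> * L2_norm M f"
    using L2_norm_le_diff[OF Vf PX(2)[OF Vf]] L2_norm_diff_commute[of M "V f" "P (V f)"] by simp
  with 1 have "L2_norm M f \<le> w * (L2_norm M (P (V f)) + \<delta> * L2_norm M f)"
    using mult_left_mono[of "L2_norm M (V f)" _ w] L2_opnorm_nonneg[OF Wlin] unfolding w_def
    by (meson order_trans)
  then have "(1 - \<delta> * w) * L2_norm M f \<le> w * L2_norm M (P (V f))"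
    by (simp add: algebra_simps)
  also have "\<dots> \<le> (a * (1 - \<delta> * w)) * L2_norm M (P (V f))"
    using a by (intro mult_right_mono L2_norm_nonneg) (simp add: w_def)
  finally have "(1 - \<delta> * w) * L2_norm M f \<le> (1 - \<delta> * w) * (a * L2_norm M (P (V f)))"
    by (simp add: mult_ac)
  then have "L2_norm M f \<le> a * L2_norm M (P (V f))"
    using a(2) unfolding w_def by (subst (asm) mult_le_cancel_left_pos) auto
  then show ?thesis
    by (simp add: euclidean_vec_norm_galerkin[OF V X P B v] euclidean_vec_norm_combination[OF X B v] f_def)
qed

text \<open>Serves the lower limit: it shows that a stability constant \<open>m\<close> of the
  matrix cannot be much smaller than |u| / |V u|. The matrix is tested on the coordinates of
  \<open>P u\<close>; replacing \<open>u\<close> by its projection costs at most K |P u - u| under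
  \<open>V\<close>, and \<open>P\<close> does not increase norms.\<close>

lemma L2_norm_projection_le_galerkin:
  assumes V: "L2_bounded_linear M V" "K \<ge> 0" "\<And>f. f \<in> L2 M \<Longrightarrow> L2_norm M (V f) \<le> K * L2_norm M f"
    and X: "L2_subspace M X" and P: "L2_orthogonal_projection M X P"
    and B: "L2_orthonormal_basis M X bs" and u: "u \<in> L2 M"
    and m: "m \<ge> 0" "\<And>v. v \<in> carrier_vec (length bs) \<Longrightarrow>
      euclidean_vec_norm v \<le> m * euclidean_vec_norm (galerkin_matrix M V bs *\<^sub>v v)"
  shows "L2_norm M (P u) \<le> m * (L2_norm M (V u) + K * L2_norm M (\<lambda>x. P u x - u x))"
proof -
  have Pu: "P u \<in> X" "P u \<in> L2 M"
    using X P u by (auto simp: L2_orthogonal_projection_def L2_subspace_def)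
  obtain c where c: "L2_eq M (P u) (\<lambda>x. \<Sum>i<length bs. c i * (bs ! i) x)"
    using B Pu(1) by (auto simp: L2_orthonormal_basis_def L2_spans_def)
  define v where "v = Matrix.vec (length bs) c"
  define f where "f = (\<lambda>x. \<Sum>i<length bs. vec_index v i * (bs ! i) x)"
  have v: "v \<in> carrier_vec (length bs)" by (simp add: v_def)
  have f: "f \<in> L2 M"
    unfolding f_def by (rule L2_orthonormal_basis_combination[OF X B])
  \<comment> \<open>\<open>V\<close> is applied to \<open>f\<close> rather than to
    \<open>P u\<close>, matching the form of the matrix identity; the two functions are exchanged
    only inside norms.\<close>
  have fu: "L2_eq M (P u) f"
    using c by (simp add: f_def v_def)
  have Vf: "V f \<in> L2 M" and Vu: "V u \<in> L2 M"
    using V(1) f u by (simp_all add: L2_bounded_linear_in)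
  have "L2_norm M (\<lambda>x. V f x - V u x) = L2_norm M (V (\<lambda>x. f x - u x))"
    by (rule L2_norm_cong[OF L2_diff[OF Vf Vu] L2_bounded_linear_in[OF V(1) L2_diff[OF f u]]
          L2_eq_sym[OF L2_bounded_linear_diff[OF V(1) f u]]])
  also have "\<dots> \<le> K * L2_norm M (\<lambda>x. f x - u x)"
    by (rule V(3)[OF L2_diff[OF f u]])
  also have "L2_norm M (\<lambda>x. f x - u x) = L2_norm M (\<lambda>x. P u x - u x)"
    using fu by (intro L2_norm_cong L2_diff f u Pu) (auto simp: L2_eq_def elim: eventually_mono)
  finally have "L2_norm M (V f) \<le> L2_norm M (V u) + K * L2_norm M (\<lambda>x. P u x - u x)"
    using L2_norm_le_diff[OF Vf Vu] by simp
  then have "L2_norm M (P (V f)) \<le> L2_norm M (V u) + K * L2_norm M (\<lambda>x. P u x - u x)"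
    using L2_norm_orthogonal_projection_le[OF X P Vf] by simp
  moreover have "L2_norm M (P u) \<le> m * L2_norm M (P (V f))"
    using m(2)[OF v] L2_norm_cong[OF Pu(2) f fu]
    by (simp add: euclidean_vec_norm_galerkin[OF V(1) X P B v] euclidean_vec_norm_combination[OF X B v] f_def)
  ultimately show ?thesis
    using m(1) mult_left_mono order_trans by blast
qed

text \<open>The limit is proved by order: every number above the norm of the inverse is eventually
  an upper bound, every number below it is eventually exceeded. Invertibility comes along with the
  upper bound.\<close>

lemma galerkin_inverse_norm_tendsto:
  assumes V: "L2_bounded_linear M V" and C: "L2_compact M C"
    and VC: "\<And>f. f \<in> L2 M \<Longrightarrow> L2_eq M (V f) (\<lambda>x. f x + C f x)"
    and inv: "L2_invertible M V"
    and X: "\<And>N. N \<ge> 1 \<Longrightarrow> L2_subspace M (X N)"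
    and P: "\<And>N. N \<ge> 1 \<Longrightarrow> L2_orthogonal_projection M (X N) (P N)"
    and lim: "\<And>f. f \<in> L2 M \<Longrightarrow> (\<lambda>N. L2_norm M (\<lambda>x. P N f x - f x)) \<longlonglongrightarrow> 0"
    and B: "\<And>N. N \<ge> 1 \<Longrightarrow> L2_orthonormal_basis M (X N) (B N)"
  shows "\<forall>\<^sub>F N in sequentially. invertible_mat (galerkin_matrix M V (B N))"
    and "(\<lambda>N. mat_norm (the (mat_inverse (galerkin_matrix M V (B N))))) \<longlonglongrightarrow> L2_opnorm M (L2_inv M V)"
proof -
  define W where "W = L2_inv M V"
  define w where "w = L2_opnorm M W"
  define G where "G N = galerkin_matrix M V (B N)" for N
  define m where "m N = mat_norm (the (mat_inverse (G N)))" for N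
  have W: "L2_inverts M V W"
    unfolding W_def by (rule L2_inverts_L2_inv[OF inv])
  then have Wlin: "L2_bounded_linear M W" by (simp add: L2_inverts_def)
  have Clin: "L2_bounded_linear M C" using C by (simp add: L2_compact_def)
  have w: "w \<ge> 0" unfolding w_def by (rule L2_opnorm_nonneg[OF Wlin])
  have G: "G N \<in> carrier_mat (length (B N)) (length (B N))" for N
    by (simp add: G_def galerkin_matrix_def)
  have below: "\<forall>\<^sub>F N in sequentially. N \<ge> 1 \<and> (\<forall>v\<in>carrier_vec (length (B N)).
      euclidean_vec_norm v \<le> a * euclidean_vec_norm (G N *\<^sub>v v))" if "a > w" for a
  proof -
    \<comment> \<open>Chosen so that a \<delta> w = (a - w) w / (w + 1) falls short of a - w, that
      is w < a (1 - \<delta> w). The summand 1 keeps the denominator positive when w = 0.\<close>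
    define \<delta> where "\<delta> = (a - w) / (a * (w + 1))"
    have \<delta>: "\<delta> > 0" using that w by (simp add: \<delta>_def)
    have "a * (\<delta> * w) = (a - w) * (w / (w + 1))"
      using that w by (simp add: \<delta>_def)
    also have "\<dots> < (a - w) * 1"
      using that w by (intro mult_strict_left_mono) auto
    finally have *: "w < a * (1 - \<delta> * w)" by (simp add: algebra_simps)
    \<comment> \<open>If \<delta> w were at least 1, the right side of the last inequality would be
      nonpositive, against w \<ge> 0.\<close>
    then have **: "\<delta> * w < 1"
      using that w by (smt (verit) mult_nonneg_nonpos)
    have "\<forall>\<^sub>F N in sequentially. \<forall>f\<in>L2 M. L2_norm M (\<lambda>x. P N (C f) x - C f x) \<le> \<delta> * L2_norm M f"
      by (rule L2_compact_projection_uniform[OF C X P lim \<delta>])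
    then show ?thesis
      using eventually_ge_at_top[of 1]
    proof eventually_elim
      case (elim N)
      then show ?case
        unfolding G_def using that w * **
        by (auto intro!: galerkin_bounded_below[OF V Clin VC W X P B, of N \<delta>] simp: w_def)
    qed
  qed
  \<comment> \<open>Stability with a single constant above \<open>w\<close> already makes
    \<open>m N\<close> itself an admissible constant, the form in which the lower limit uses
    it.\<close>
  have ev: "\<forall>\<^sub>F N in sequentially. N \<ge> 1 \<and> invertible_mat (G N) \<and> 0 \<le> m N \<and> m N \<le> a \<and>
      (\<forall>v\<in>carrier_vec (length (B N)). euclidean_vec_norm v \<le> m N * euclidean_vec_norm (G N *\<^sub>v v))"
    if "a > w" for a
    using below[OF that]
  proof eventually_elim
    case (elim N)
    have "a \<ge> 0" using that w by simp
    then show ?case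
      unfolding m_def
      using elim invertible_mat_of_bounded_below[OF G] mat_norm_inverse_le[OF G] mat_norm_inverse_nonneg[OF G]
        euclidean_vec_norm_le_inverse[OF G] by blast
  qed
  show "\<forall>\<^sub>F N in sequentially. invertible_mat (galerkin_matrix M V (B N))"
    using ev[OF less_add_one] unfolding G_def by (auto elim: eventually_mono)
  have "m \<longlonglongrightarrow> w"
  proof (rule order_tendstoI)
    fix a assume "w < a"
    \<comment> \<open>\<open>ev\<close> bounds \<open>m N\<close> only non-strictly, so an
      intermediate \<open>b\<close> supplies strictness.\<close>
    then obtain b where "w < b" "b < a" using dense by blast
    from ev[OF this(1)] show "\<forall>\<^sub>F N in sequentially. m N < a"
      by eventually_elim (use \<open>b < a\<close> in auto)
  next
    fix a assume "a < w"
    \<comment> \<open>\<open>g\<close> exceeds \<open>a\<close> under \<open>W\<close>; its image u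
      = W g satisfies V u = g almost everywhere and so has |V u| \<le> 1.\<close>
    obtain g where g: "g \<in> L2 M" "L2_norm M g \<le> 1" "a < L2_norm M (W g)"
      using less_L2_opnormD[of a M W] \<open>a < w\<close> unfolding w_def by blast
    define u where "u = W g"
    define e where "e N = L2_norm M (\<lambda>x. P N u x - u x)" for N
    have u: "u \<in> L2 M" using g Wlin by (simp add: u_def L2_bounded_linear_in)
    have "L2_norm M (V u) = L2_norm M g"
      using W g(1) u V by (intro L2_norm_cong) (auto simp: u_def L2_inverts_def L2_bounded_linear_in)
    with g have Vu: "L2_norm M (V u) \<le> 1" by simp
    obtain K where K: "K \<ge> 0" "\<And>f. f \<in> L2 M \<Longrightarrow> L2_norm M (V f) \<le> K * L2_norm M f"
      using L2_bounded_linear_bound[OF V] by blast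
    have e: "e \<longlonglongrightarrow> 0" unfolding e_def by (rule lim[OF u])
    \<comment> \<open>Solving |u| - e \<le> m (1 + K e) for m gives this quotient as a lower bound;
      as e tends to 0 it tends to |u|, which exceeds \<open>a\<close>.\<close>
    have "(\<lambda>N. (L2_norm M u - e N) / (1 + K * e N)) \<longlonglongrightarrow> (L2_norm M u - 0) / (1 + K * 0)"
      by (intro tendsto_intros e) simp
    then have "\<forall>\<^sub>F N in sequentially. a < (L2_norm M u - e N) / (1 + K * e N)"
      using g(3) by (intro order_tendstoD(1)) (auto simp: u_def)
    then show "\<forall>\<^sub>F N in sequentially. a < m N"
      using ev[OF less_add_one]
    proof eventually_elim
      case (elim N)
      then have N: "N \<ge> 1" by simp
      have Pu: "P N u \<in> L2 M"
        using X[OF N] P[OF N] u by (auto simp: L2_orthogonal_projection_def L2_subspace_def)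
      have eN: "0 \<le> e N" by (simp add: e_def L2_norm_nonneg)
      have "L2_norm M u - e N \<le> L2_norm M (P N u)"
        using L2_norm_le_diff[OF u Pu] L2_norm_diff_commute[of M u "P N u"] by (simp add: e_def)
      also have "\<dots> \<le> m N * (L2_norm M (V u) + K * e N)"
        unfolding e_def using elim
        by (intro L2_norm_projection_le_galerkin[OF V K X[OF N] P[OF N] B[OF N] u]) (auto simp: G_def)
      also have "\<dots> \<le> m N * (1 + K * e N)"
        using elim Vu by (intro mult_left_mono) auto
      finally have "(L2_norm M u - e N) / (1 + K * e N) \<le> m N"
        using K(1) eN by (simp add: pos_divide_le_eq add_pos_nonneg)
      then show ?case using elim by simp
    qed
  qed
  then show "(\<lambda>N. mat_norm (the (mat_inverse (galerkin_matrix M V (B N))))) \<longlonglongrightarrow> L2_opnorm M (L2_inv M V)"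
    by (simp add: m_def[abs_def] G_def w_def W_def)
qed

theorem mainTheorem7:
  fixes \<Omega> :: "(real ^ 'd) set"
    and V C :: "(real ^ 'd \<Rightarrow> complex) \<Rightarrow> (real ^ 'd \<Rightarrow> complex)"
    and X :: "nat \<Rightarrow> (real ^ 'd \<Rightarrow> complex) set"
    and P :: "nat \<Rightarrow> (real ^ 'd \<Rightarrow> complex) \<Rightarrow> (real ^ 'd \<Rightarrow> complex)"
    and B :: "nat \<Rightarrow> (real ^ 'd \<Rightarrow> complex) list"
  defines "M \<equiv> surface_measure (frontier \<Omega>)"
  assumes "CARD('d) = 2 \<or> CARD('d) = 3"
    and "compact \<Omega>" and "lipschitz_boundary \<Omega>" and "connected (- \<Omega>)"
    and "L2_bounded_linear M V"
    and "L2_compact M C"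
    and "\<And>\<phi>. \<phi> \<in> L2 M \<Longrightarrow> L2_eq M (V \<phi>) (\<lambda>x. \<phi> x + C \<phi> x)"
    and "L2_invertible M V"
    and "\<And>N. N \<ge> 1 \<Longrightarrow> L2_subspace M (X N)"
    and "\<And>N. N \<ge> 1 \<Longrightarrow> L2_finite_dim M (X N)"
    and "\<And>N. N \<ge> 1 \<Longrightarrow> L2_orthogonal_projection M (X N) (P N)"
    and "\<And>\<phi>. \<phi> \<in> L2 M \<Longrightarrow> (\<lambda>N. L2_norm M (\<lambda>x. P N \<phi> x - \<phi> x)) \<longlonglongrightarrow> 0"
    and "\<And>N. N \<ge> 1 \<Longrightarrow> L2_orthonormal_basis M (X N) (B N)"
  shows "(\<forall>\<^sub>F N in sequentially. invertible_mat (galerkin_matrix M V (B N))) \<and>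
    (\<lambda>N. mat_norm (the (mat_inverse (galerkin_matrix M V (B N))))) \<longlonglongrightarrow> L2_opnorm M (L2_inv M V)"
  using galerkin_inverse_norm_tendsto[of M V C X P B] assms by simp

end
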